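(* Let $w_1,w_2,w_3$ be any odd positive integers. Then for every integer $n\ge 0$ and every $y_1\in\mathbb{Z}_p$, the following three expressions are equal: \begin{align*} &\sum_{k+l+m=n}\binom{n}{k,l,m}E_{k,\chi}(w_1y_1)T_l(w_2d-1,\chi)T_m(w_3d-1,\chi)\,w_{1}^{l+m}w_{2}^{k+m}w_{3}^{k+l}\\ =&\sum_{k+l+m=n}\binom{n}{k,l,m}E_{k,\chi}(w_2y_1)T_l(w_3d-1,\chi)T_m(w_1d-1,\chi)\,w_{2}^{l+m}w_{3}^{k+m}w_{1}^{k+l}\\ =&\sum_{k+l+m=n}\binom{n}{k,l,m}E_{k,\chi}(w_3y_1)T_l(w_1d-1,\chi)T_m(w_2d-1,\chi)\,w_{3}^{l+m}w_{1}^{k+m}w_{2}^{k+l}. \end{align*} Here each sum is over all nonnegative integers $k,l,m$ with $k+l+m=n$.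
   Context: $p$ is a fixed odd prime, $\mathbb{Z}_p$ is the ring of $p$-adic integers, and $\mathbb{C}_p$ is the completion of an algebraic closure of $\mathbb{Q}_p$. $d$ is a fixed odd positive integer and $\chi$ is a (primitive) Dirichlet character of conductor $d$, with values in $\overline{\mathbb{Q}}$, regarded as $\mathbb{C}_p$-valued through a fixed embedding $\overline{\mathbb{Q}}\to\mathbb{C}_p$; as usual $\chi(a)=0$ when $\gcd(a,d)>1$ (and $\chi\equiv 1$ if $d=1$). The generalized Euler polynomials $E_{n,\chi}(x)$ attached to $\chi$ are the polynomials in $x$ defined by $$\frac{2e^{xt}}{e^{dt}+1}\sum_{a=0}^{d-1}(-1)^a\chi(a)e^{at}=\sum_{n=0}^{\infty}E_{n,\chi}(x)\frac{t^n}{n!}.$$ For integers $k,n\ge 0$, the $k$th alternating generalized power sum attached to $\chi$ is $T_k(n,\chi)=\sum_{a=0}^{n}(-1)^a\chi(a)a^k$, with the convention $0^0=1$. The multinomial coefficient is $\binom{n}{k,l,m}=\frac{n!}{k!\,l!\,m!}$. *)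

theory Defs
  imports
    "HOL-Analysis.Elementary_Metric_Spaces"
    "HOL-Computational_Algebra.Computational_Algebra"
    "HOL-Number_Theory.Cong"
begin

section \<open>The field of $p$-adic complex numbers\<close>

definition padic_abs_rat :: "nat \<Rightarrow> rat \<Rightarrow> real" where
  "padic_abs_rat p q = (if q = 0 then 0 else
     real p powi (int (multiplicity (int p) (snd (quotient_of q)))
                  - int (multiplicity (int p) (fst (quotient_of q)))))"

text \<open>
  A type cannot depend on the number $p$, so $\mathbb{C}_p$ is introduced through its definition:
  it is a complete valued field \<open>'a\<close>, with absolute value \<^term>\<open>\<lambda>x. dist x 0\<close>, in which the
  completion of $\mathbb{Q}$ for the $p$-adic absolute value (the closure of \<^term>\<open>\<rat>\<close>) has an
  algebraic closure that is dense. This determines $\mathbb{C}_p$ up to isometric isomorphism.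
\<close>

definition Qp :: "'a :: {field_char_0, metric_space} set" where
  "Qp = closure \<rat>"

definition Zp :: "'a :: {field_char_0, metric_space} set" where
  "Zp = {x \<in> Qp. dist x 0 \<le> 1}"

definition algebraic_over :: "'a :: field set \<Rightarrow> 'a \<Rightarrow> bool" where
  "algebraic_over K x \<longleftrightarrow> (\<exists>f. f \<noteq> 0 \<and> (\<forall>i. coeff f i \<in> K) \<and> poly f x = 0)"

definition algebraically_closed_on :: "'a :: field set \<Rightarrow> bool" where
  "algebraically_closed_on L \<longleftrightarrow>
     (\<forall>f. (\<forall>i. coeff f i \<in> L) \<and> degree f > 0 \<longrightarrow> (\<exists>x\<in>L. poly f x = 0))"

definition padic_complex_field :: "nat \<Rightarrow> 'a :: {field_char_0, complete_space} itself \<Rightarrow> bool" where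
  "padic_complex_field p Cp \<longleftrightarrow> prime p \<and>
     (\<forall>x y :: 'a. dist x y = dist (x - y) 0) \<and>
     (\<forall>x y :: 'a. dist (x * y) 0 = dist x 0 * dist y 0) \<and>
     (\<forall>x y :: 'a. dist (x + y) 0 \<le> max (dist x 0) (dist y 0)) \<and>
     (\<forall>q. dist (of_rat q :: 'a) 0 = padic_abs_rat p q) \<and>
     algebraically_closed_on {x :: 'a. algebraic_over Qp x} \<and>
     closure {x :: 'a. algebraic_over Qp x} = UNIV"


section \<open>Dirichlet characters\<close>

definition dirichlet_character :: "nat \<Rightarrow> (int \<Rightarrow> 'a :: field) \<Rightarrow> bool" where
  "dirichlet_character d \<chi> \<longleftrightarrow> d > 0 \<and>
     (\<forall>a b. [a = b] (mod int d) \<longrightarrow> \<chi> a = \<chi> b) \<and>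
     (\<forall>a b. \<chi> (a * b) = \<chi> a * \<chi> b) \<and>
     \<chi> 1 = 1 \<and>
     (\<forall>a. \<chi> a = 0 \<longleftrightarrow> \<not> coprime a (int d))"

definition conductor :: "nat \<Rightarrow> (int \<Rightarrow> 'a :: field) \<Rightarrow> nat" where
  "conductor d \<chi> = (LEAST c. c > 0 \<and> c dvd d \<and>
     (\<forall>a. coprime a (int d) \<and> [a = 1] (mod int c) \<longrightarrow> \<chi> a = 1))"

definition primitive_dirichlet_character :: "nat \<Rightarrow> (int \<Rightarrow> 'a :: field) \<Rightarrow> bool" where
  "primitive_dirichlet_character d \<chi> \<longleftrightarrow> dirichlet_character d \<chi> \<and> conductor d \<chi> = d"

definition Qbar :: "complex set" where
  "Qbar = {z. algebraic z}"

text \<open>Only the values of \<open>\<iota>\<close> on the subfield \<open>K\<close> matter; injectivity is automatic.\<close>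

definition field_embedding_on :: "'a :: field set \<Rightarrow> ('a \<Rightarrow> 'b :: field) \<Rightarrow> bool" where
  "field_embedding_on K \<iota> \<longleftrightarrow> \<iota> 1 = 1 \<and>
     (\<forall>x\<in>K. \<forall>y\<in>K. \<iota> (x + y) = \<iota> x + \<iota> y \<and> \<iota> (x * y) = \<iota> x * \<iota> y)"


section \<open>Generalized Euler polynomials and alternating power sums\<close>

text \<open>
  The generating function is a power series in $t$ whose coefficients are polynomials in $x$.
  The factor not involving $x$ is computed over the field (the constant term of $e^{dt}+1$ is $2$)
  and then embedded coefficientwise; the factor $e^{xt}$ has coefficients $x^n/n!$.
\<close>

definition gen_euler_series :: "nat \<Rightarrow> (int \<Rightarrow> 'a :: field_char_0) \<Rightarrow> 'a fps" where
  "gen_euler_series d \<chi> =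
     fps_const 2 / (fps_exp (of_nat d) + 1) *
     (\<Sum>a<d. fps_const ((-1) ^ a * \<chi> (int a)) * fps_exp (of_nat a))"

definition gen_euler_gf :: "nat \<Rightarrow> (int \<Rightarrow> 'a :: field_char_0) \<Rightarrow> 'a poly fps" where
  "gen_euler_gf d \<chi> =
     Abs_fps (\<lambda>n. monom (1 / fact n) n) * Abs_fps (\<lambda>n. [:fps_nth (gen_euler_series d \<chi>) n:])"

definition gen_euler_poly :: "nat \<Rightarrow> (int \<Rightarrow> 'a :: field_char_0) \<Rightarrow> nat \<Rightarrow> 'a poly" where
  "gen_euler_poly d \<chi> n = smult (fact n) (fps_nth (gen_euler_gf d \<chi>) n)"

lemma gen_euler_poly_generating_function:
  fixes \<chi> :: "int \<Rightarrow> 'a :: field_char_0"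
  shows "fps_const 2 * fps_exp x / (fps_exp (of_nat d) + 1) *
           (\<Sum>a<d. fps_const ((-1) ^ a * \<chi> (int a)) * fps_exp (of_nat a)) =
         Abs_fps (\<lambda>n. poly (gen_euler_poly d \<chi> n) x / fact n)"
proof -
  have u: "fps_nth (fps_exp (of_nat d :: 'a) + 1) 0 \<noteq> 0"
    by simp
  have "fps_const 2 * fps_exp x / (fps_exp (of_nat d) + 1) *
          (\<Sum>a<d. fps_const ((-1) ^ a * \<chi> (int a)) * fps_exp (of_nat a)) =
        fps_exp x * gen_euler_series d \<chi>"
    unfolding gen_euler_series_def fps_divide_unit[OF u] by (simp only: mult_ac)
  also have "\<dots> = Abs_fps (\<lambda>n. poly (gen_euler_poly d \<chi> n) x / fact n)"
    by (rule fps_ext)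
       (simp add: gen_euler_poly_def gen_euler_gf_def fps_mult_nth poly_sum poly_monom mult.commute)
  finally show ?thesis .
qed

definition alt_power_sum :: "(int \<Rightarrow> 'a :: field_char_0) \<Rightarrow> nat \<Rightarrow> nat \<Rightarrow> 'a" where
  "alt_power_sum \<chi> k n = (\<Sum>a\<le>n. (-1) ^ a * \<chi> (int a) * of_nat a ^ k)"

definition trinomial :: "nat \<Rightarrow> nat \<Rightarrow> nat \<Rightarrow> nat \<Rightarrow> 'a :: field_char_0" where
  "trinomial n k l m = fact n / (fact k * fact l * fact m)"

end

theory Submission
  imports Defs
begin

text \<open>
  Put $S(u)=\sum_{a<d}(-1)^a\chi(a)e^{au}$. As $d$ and $w$ are odd and $\chi$ has period $d$,
  $\sum_{a<wd}(-1)^a\chi(a)e^{au}=S(u)\,(e^{wdu}+1)/(e^{du}+1)$. Hence, up to the factor $n!$, each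
  of the three sums is the coefficient of $t^n$ in
  \[\frac{2e^{w_1w_2w_3y_1t}\,(e^{dw_1w_2w_3t}+1)^2\,S(w_2w_3t)\,S(w_1w_3t)\,S(w_1w_2t)}
    {(e^{dw_2w_3t}+1)\,(e^{dw_1w_3t}+1)\,(e^{dw_1w_2t}+1)},\]
  which is symmetric in $w_1,w_2,w_3$.
\<close>

text \<open>For \<open>N = d\<close> this is S(ct) in the notation above. The scale \<open>c\<close>
  sits inside the exponents because the three factors of the product use three different
  scales.\<close>

definition alt_exp_sum :: "nat \<Rightarrow> (int \<Rightarrow> 'a) \<Rightarrow> 'a \<Rightarrow> 'a :: field_char_0 fps" where
  "alt_exp_sum N \<chi> c = (\<Sum>a<N. fps_const ((-1) ^ a * \<chi> (int a)) * fps_exp (c * of_nat a))"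

text \<open>The constant term is 2, nonzero in characteristic 0. This is what allows the
  denominators to be cancelled at the end.\<close>

lemma fps_exp_plus_1_nonzero: "fps_exp (c :: 'a :: field_char_0) + 1 \<noteq> 0"
proof
  assume "fps_exp c + 1 = 0"
  then have "fps_nth (fps_exp c + 1) 0 = 0" by simp
  then show False by simp
qed

text \<open>Two nested Cauchy products: the outer index is i = k + l, the degree taken from
  \<open>f * g\<close>, and the inner one is j = k.\<close>

lemma fps_mult3_nth:
  fixes f g h :: "'a :: comm_ring_1 fps"
  shows "fps_nth (f * g * h) n =
    (\<Sum>(k, l, m) \<in> {(k, l, m). k + l + m = n}. fps_nth f k * fps_nth g l * fps_nth h m)"
proof -
  have "fps_nth (f * g * h) n =
      (\<Sum>(i, j) \<in> Sigma {0..n} (\<lambda>i. {0..i}). fps_nth f j * fps_nth g (i - j) * fps_nth h (n - i))"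
    by (simp add: fps_mult_nth sum_distrib_right sum.Sigma)
  also have "\<dots> =
      (\<Sum>(k, l, m) \<in> {(k, l, m). k + l + m = n}. fps_nth f k * fps_nth g l * fps_nth h m)"
    by (rule sum.reindex_bij_witness[where i = "\<lambda>(k, l, m). (k + l, k)"
          and j = "\<lambda>(i, j). (j, i - j, n - i)"]) auto
  finally show ?thesis .
qed

text \<open>Substituting ct for t in the generating function multiplies the n-th coefficient by c^n.
  The denominator is cleared first, so that the substitution passes only through sums and
  products.\<close>

lemma gen_euler_poly_fps_scaled:
  fixes \<chi> :: "int \<Rightarrow> 'a :: field_char_0"
  shows "(fps_exp (c * of_nat d) + 1) * Abs_fps (\<lambda>n. c ^ n * (poly (gen_euler_poly d \<chi> n) x / fact n)) =
    fps_const 2 * fps_exp (c * x) * alt_exp_sum d \<chi> c"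
proof -
  let ?L = "fps_const c * fps_X"
  let ?E = "Abs_fps (\<lambda>n. poly (gen_euler_poly d \<chi> n) x / fact n)"
  have u: "fps_nth (fps_exp (of_nat d :: 'a) + 1) 0 \<noteq> 0"
    by simp
  have "(fps_exp (of_nat d) + 1) * ?E =
      ((fps_exp (of_nat d) + 1) * inverse (fps_exp (of_nat d) + 1)) *
      (fps_const 2 * fps_exp x * (\<Sum>a<d. fps_const ((-1) ^ a * \<chi> (int a)) * fps_exp (of_nat a)))"
    unfolding gen_euler_poly_generating_function[symmetric] fps_divide_unit[OF u]
    by (simp only: mult_ac)
  also have "(fps_exp (of_nat d :: 'a) + 1) * inverse (fps_exp (of_nat d) + 1) = 1"
    using inverse_mult_eq_1'[OF u] .
  finally have "((fps_exp (of_nat d) + 1) * ?E) oo ?L =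
      (fps_const 2 * fps_exp x * (\<Sum>a<d. fps_const ((-1) ^ a * \<chi> (int a)) * fps_exp (of_nat a))) oo ?L"
    by simp
  moreover have "Abs_fps (\<lambda>n. c ^ n * (poly (gen_euler_poly d \<chi> n) x / fact n)) = ?E oo ?L"
    by (simp add: fps_compose_linear)
  ultimately show ?thesis
    by (simp add: fps_compose_mult_distrib fps_compose_add_distrib fps_compose_sum_distrib
        fps_exp_compose_linear alt_exp_sum_def)
qed

lemma alt_power_sum_fps:
  fixes \<chi> :: "int \<Rightarrow> 'a :: field_char_0"
  assumes "N > 0"
  shows "Abs_fps (\<lambda>k. c ^ k * (alt_power_sum \<chi> k (N - 1) / fact k)) = alt_exp_sum N \<chi> c"
proof -
  \<comment> \<open>Positivity matters here: for \<open>N = 0\<close> the truncated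
    \<open>N - 1\<close> is 0, and the left side would still contain 0.\<close>
  have "{..N - 1} = {..<N}"
    using assms by auto
  then show ?thesis
    by (intro fps_ext)
       (simp add: alt_exp_sum_def alt_power_sum_def fps_sum_nth sum_divide_distrib
          sum_distrib_left power_mult_distrib mult_ac)
qed

text \<open>Shifting the last \<open>M\<close> indices down by the period \<open>N\<close> leaves
  the character values alone and produces the factor (-1)^N e^{cNt}.\<close>

lemma alt_exp_sum_add_period:
  fixes \<chi> :: "int \<Rightarrow> 'a :: field_char_0"
  assumes "\<And>a. \<chi> (a + int N) = \<chi> a"
  shows "alt_exp_sum (N + M) \<chi> c =
    alt_exp_sum N \<chi> c + (-1) ^ N * fps_exp (c * of_nat N) * alt_exp_sum M \<chi> c"
proof -
  have "alt_exp_sum (N + M) \<chi> c = alt_exp_sum N \<chi> c +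
      (\<Sum>a<M. fps_const ((-1) ^ (a + N) * \<chi> (int a + int N)) * fps_exp (c * of_nat (a + N)))"
    unfolding alt_exp_sum_def
    by (induction M) (simp_all add: add_ac)
  also have "(\<Sum>a<M. fps_const ((-1) ^ (a + N) * \<chi> (int a + int N)) * fps_exp (c * of_nat (a + N)))
      = (-1) ^ N * fps_exp (c * of_nat N) * alt_exp_sum M \<chi> c"
    unfolding alt_exp_sum_def sum_distrib_left
    by (intro sum.cong refl)
       (simp add: assms power_add distrib_left fps_exp_add_mult mult_ac
          flip: fps_const_mult fps_const_power fps_const_neg)
  finally show ?thesis .
qed

text \<open>Cutting the range into \<open>w\<close> blocks of length \<open>d\<close> gives a
  geometric series with ratio -e^{cdt}, the sign being due to odd \<open>d\<close>; the factor on
  the left is 1 minus this ratio. The sign \<open>(-1) ^ w\<close> is kept because the induction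
  step changes the parity of \<open>w\<close>.\<close>

lemma alt_exp_sum_mult_period:
  fixes \<chi> :: "int \<Rightarrow> 'a :: field_char_0"
  assumes per: "\<And>a. \<chi> (a + int d) = \<chi> a" and "odd d"
  shows "(fps_exp (c * of_nat d) + 1) * alt_exp_sum (w * d) \<chi> c =
    (1 - (-1) ^ w * fps_exp (c * of_nat (w * d))) * alt_exp_sum d \<chi> c"
proof (induction w)
  case 0
  then show ?case by (simp add: alt_exp_sum_def)
next
  case (Suc w)
  let ?e = "fps_exp (c * of_nat d)"
  have step: "alt_exp_sum (Suc w * d) \<chi> c = alt_exp_sum d \<chi> c - ?e * alt_exp_sum (w * d) \<chi> c"
    using alt_exp_sum_add_period[of \<chi> d "w * d" c, OF per] \<open>odd d\<close> by simp
  have "(?e + 1) * alt_exp_sum (Suc w * d) \<chi> c =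
      (?e + 1) * alt_exp_sum d \<chi> c - ?e * ((?e + 1) * alt_exp_sum (w * d) \<chi> c)"
    unfolding step by (simp add: algebra_simps)
  also have "\<dots> = (1 + (-1) ^ w * (?e * fps_exp (c * of_nat (w * d)))) * alt_exp_sum d \<chi> c"
    unfolding Suc.IH by (simp add: algebra_simps)
  also have "?e * fps_exp (c * of_nat (w * d)) = fps_exp (c * of_nat (Suc w * d))"
    by (simp add: distrib_left flip: fps_exp_add_mult)
  finally show ?case by simp
qed

text \<open>A single rotation is enough: applied to (w1, w2, w3) and then to (w2, w3, w1), it yields
  both equalities of the theorem.\<close>

lemma euler_power_sum_cyclic:
  fixes \<chi> :: "int \<Rightarrow> 'a :: field_char_0" and y :: 'a and d n w1 w2 w3 :: nat
  defines "T \<equiv> \<lambda>u v w. \<Sum>(k, l, m) \<in> {(k, l, m). k + l + m = n}.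
      trinomial n k l m * poly (gen_euler_poly d \<chi> k) (of_nat u * y)
      * alt_power_sum \<chi> l (v * d - 1) * alt_power_sum \<chi> m (w * d - 1)
      * of_nat u ^ (l + m) * of_nat v ^ (k + m) * of_nat w ^ (k + l)"
  assumes per: "\<And>a. \<chi> (a + int d) = \<chi> a" and "odd d"
    and "odd w1" "odd w2" "odd w3"
  shows "T w1 w2 w3 = T w2 w3 w1"
proof -
  define E where "E u c = Abs_fps (\<lambda>k. c ^ k * (poly (gen_euler_poly d \<chi> k) (of_nat u * y) / fact k))"
    for u :: nat and c
  \<comment> \<open>The scales come from regrouping the weights: u^{l+m} v^{k+m} w^{k+l} = (vw)^k
    (uw)^l (uv)^m, so each factor absorbs one power.\<close>
  define G where "G u v w = E u (of_nat (v * w)) * alt_exp_sum (v * d) \<chi> (of_nat (u * w))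
      * alt_exp_sum (w * d) \<chi> (of_nat (u * v))" for u v w :: nat
  define D where "D c = fps_exp (of_nat (c * d) :: 'a) + 1" for c :: nat
  have T_eq: "T u v w = fact n * fps_nth (G u v w) n" if "odd v" "odd w" for u v w
  proof -
    have "v * d > 0" "w * d > 0"
      using that \<open>odd d\<close> by (auto intro: odd_pos)
    then have "alt_exp_sum (v * d) \<chi> c = Abs_fps (\<lambda>k. c ^ k * (alt_power_sum \<chi> k (v * d - 1) / fact k))"
      and "alt_exp_sum (w * d) \<chi> c = Abs_fps (\<lambda>k. c ^ k * (alt_power_sum \<chi> k (w * d - 1) / fact k))" for c
      by (simp_all only: alt_power_sum_fps)
    then show ?thesis
      unfolding T_def G_def E_def fps_mult3_nth sum_distrib_left
      by (intro sum.cong refl) (auto simp: trinomial_def power_add power_mult_distrib)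
  qed
  \<comment> \<open>The argument uy at scale vw gives the exponent uvwy, which is already
    symmetric.\<close>
  have D_E: "D (v * w) * E u (of_nat (v * w)) =
      fps_const 2 * fps_exp (of_nat (u * v * w) * y) * alt_exp_sum d \<chi> (of_nat (v * w))" for u v w
    using gen_euler_poly_fps_scaled[of "of_nat (v * w)" d \<chi> "of_nat u * y"]
    by (simp add: E_def D_def mult_ac)
  \<comment> \<open>For odd \<open>v\<close> the numerator 1 - (-1)^v e^{cvdt} becomes e^{cvdt} + 1,
    which is \<open>D (c * v)\<close>.\<close>
  have D_S: "D c * alt_exp_sum (v * d) \<chi> (of_nat c) = D (c * v) * alt_exp_sum d \<chi> (of_nat c)"
    if "odd v" for c v
    using alt_exp_sum_mult_period[of \<chi> d "of_nat c" v, OF per \<open>odd d\<close>] that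
    by (simp add: D_def mult_ac add_ac)
  \<comment> \<open>Multiplying by all three denominators avoids division; the right side is then
    visibly unchanged when u, v, w are rotated.\<close>
  have G_eq: "D (v * w) * D (u * w) * D (u * v) * G u v w =
      fps_const 2 * fps_exp (of_nat (u * v * w) * y) * D (u * v * w) ^ 2
      * (alt_exp_sum d \<chi> (of_nat (v * w)) * alt_exp_sum d \<chi> (of_nat (u * w))
         * alt_exp_sum d \<chi> (of_nat (u * v)))" if "odd v" "odd w" for u v w
  proof -
    have "D (v * w) * D (u * w) * D (u * v) * G u v w =
        (D (v * w) * E u (of_nat (v * w)))
        * (D (u * w) * alt_exp_sum (v * d) \<chi> (of_nat (u * w)))
        * (D (u * v) * alt_exp_sum (w * d) \<chi> (of_nat (u * v)))"
      by (simp only: G_def mult_ac)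
    also have "\<dots> = fps_const 2 * fps_exp (of_nat (u * v * w) * y) * alt_exp_sum d \<chi> (of_nat (v * w))
        * (D (u * w * v) * alt_exp_sum d \<chi> (of_nat (u * w)))
        * (D (u * v * w) * alt_exp_sum d \<chi> (of_nat (u * v)))"
      by (simp only: D_E D_S[OF that(1)] D_S[OF that(2)])
    finally show ?thesis
      by (simp only: power2_eq_square mult_ac)
  qed
  let ?D = "D (w2 * w3) * D (w1 * w3) * D (w1 * w2)"
  have "?D * G w1 w2 w3 = ?D * G w2 w3 w1"
    using G_eq[OF \<open>odd w2\<close> \<open>odd w3\<close>, of w1] G_eq[OF \<open>odd w3\<close> \<open>odd w1\<close>, of w2]
    by (simp only: mult_ac)
  \<comment> \<open>Power series over a field have no zero divisors, so the nonzero common factor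
    cancels.\<close>
  moreover have "?D \<noteq> 0"
    by (simp only: D_def mult_eq_0_iff fps_exp_plus_1_nonzero simp_thms)
  ultimately have "G w1 w2 w3 = G w2 w3 w1"
    by (rule mult_left_cancel[THEN iffD1, rotated])
  then show ?thesis
    by (simp add: T_eq \<open>odd w1\<close> \<open>odd w2\<close> \<open>odd w3\<close>)
qed

theorem theorem4p4:
  fixes p d n w1 w2 w3 :: nat
    and \<chi> :: "int \<Rightarrow> complex"
    and \<iota> :: "complex \<Rightarrow> 'a :: {field_char_0, complete_space}"
    and y1 :: 'a
  assumes "prime p" and "odd p"
    and "padic_complex_field p TYPE('a)"
    and "d > 0" and "odd d"
    and "primitive_dirichlet_character d \<chi>" and "range \<chi> \<subseteq> Qbar"
    and "field_embedding_on Qbar \<iota>"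
    and "w1 > 0" and "odd w1" and "w2 > 0" and "odd w2" and "w3 > 0" and "odd w3"
    and "y1 \<in> Zp"
  shows "(\<Sum>(k, l, m) \<in> {(k, l, m). k + l + m = n}.
            trinomial n k l m * poly (gen_euler_poly d (\<iota> \<circ> \<chi>) k) (of_nat w1 * y1)
            * alt_power_sum (\<iota> \<circ> \<chi>) l (w2 * d - 1) * alt_power_sum (\<iota> \<circ> \<chi>) m (w3 * d - 1)
            * of_nat w1 ^ (l + m) * of_nat w2 ^ (k + m) * of_nat w3 ^ (k + l))
       = (\<Sum>(k, l, m) \<in> {(k, l, m). k + l + m = n}.
            trinomial n k l m * poly (gen_euler_poly d (\<iota> \<circ> \<chi>) k) (of_nat w2 * y1)
            * alt_power_sum (\<iota> \<circ> \<chi>) l (w3 * d - 1) * alt_power_sum (\<iota> \<circ> \<chi>) m (w1 * d - 1)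
            * of_nat w2 ^ (l + m) * of_nat w3 ^ (k + m) * of_nat w1 ^ (k + l))
       \<and> (\<Sum>(k, l, m) \<in> {(k, l, m). k + l + m = n}.
            trinomial n k l m * poly (gen_euler_poly d (\<iota> \<circ> \<chi>) k) (of_nat w2 * y1)
            * alt_power_sum (\<iota> \<circ> \<chi>) l (w3 * d - 1) * alt_power_sum (\<iota> \<circ> \<chi>) m (w1 * d - 1)
            * of_nat w2 ^ (l + m) * of_nat w3 ^ (k + m) * of_nat w1 ^ (k + l))
       = (\<Sum>(k, l, m) \<in> {(k, l, m). k + l + m = n}.
            trinomial n k l m * poly (gen_euler_poly d (\<iota> \<circ> \<chi>) k) (of_nat w3 * y1)
            * alt_power_sum (\<iota> \<circ> \<chi>) l (w1 * d - 1) * alt_power_sum (\<iota> \<circ> \<chi>) m (w2 * d - 1)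
            * of_nat w3 ^ (l + m) * of_nat w1 ^ (k + m) * of_nat w2 ^ (k + l))"
proof -
  have "\<chi> (a + int d) = \<chi> a" for a
  proof -
    have "[a + int d = a] (mod int d)"
      by (simp add: cong_def)
    then show ?thesis
      using assms(6) unfolding primitive_dirichlet_character_def dirichlet_character_def by blast
  qed
  then have "(\<iota> \<circ> \<chi>) (a + int d) = (\<iota> \<circ> \<chi>) a" for a
    by simp
  note cyclic = euler_power_sum_cyclic[where \<chi> = "\<iota> \<circ> \<chi>", OF this \<open>odd d\<close>]
  show ?thesis
    using cyclic[OF \<open>odd w1\<close> \<open>odd w2\<close> \<open>odd w3\<close>] cyclic[OF \<open>odd w2\<close> \<open>odd w3\<close> \<open>odd w1\<close>]
    by (rule conjI)
qed

end
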